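(* For every integer $r\geq 3$, the number of $4\times 4$ Hadamard matrices $\mathrm{Hada}(a,b,c,d)$ over the finite field $\mathbb{F}_{2^r}$ that are both involutory and MDS is exactly $$(2^r-2)(2^r-4)(2^r-7).$$
   Context: For $a,b,c,d\in\mathbb{F}_{2^r}$, $\mathrm{Hada}(a,b,c,d)$ denotes the (finite field) Hadamard matrix $$\begin{bmatrix} a&b&c&d\\ b&a&d&c\\ c&d&a&b\\ d&c&b&a\end{bmatrix}.$$ A square matrix $M$ over a field is an MDS matrix if every square submatrix of $M$ (formed by any $i$ rows and any $i$ columns, $i\ge 1$, including $M$ itself) is nonsingular. An $n\times n$ matrix $M$ is involutory if $M^2=I_n$. *)

theory Defs
  imports
    "Jordan_Normal_Form.Determinant"
    "Jordan_Normal_Form.DL_Submatrix"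
begin

definition Hada :: "'a \<Rightarrow> 'a \<Rightarrow> 'a \<Rightarrow> 'a \<Rightarrow> 'a mat" where
  "Hada a b c d = mat_of_rows_list 4
     [[a, b, c, d],
      [b, a, d, c],
      [c, d, a, b],
      [d, c, b, a]]"

(* I and J are the selected rows and columns, counted from 0; submatrix keeps them in
   increasing order. *)
definition MDS_mat :: "'a :: field mat \<Rightarrow> bool" where
  "MDS_mat M \<longleftrightarrow> square_mat M \<and>
     (\<forall>I J. I \<subseteq> {..<dim_row M} \<longrightarrow> J \<subseteq> {..<dim_col M} \<longrightarrow> card I = card J \<longrightarrow> card I \<ge> 1 \<longrightarrow>
        det (submatrix M I J) \<noteq> 0)"

definition involutory_mat :: "'a :: semiring_1 mat \<Rightarrow> bool" where
  "involutory_mat M \<longleftrightarrow> square_mat M \<and> M * M = 1\<^sub>m (dim_row M)"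

end

theory Submission
  imports Defs "HOL-Number_Theory.Residues"
begin

text \<open>In characteristic 2 the square of \<open>Hada a b c d\<close> is \<open>(a + b + c + d)\<^sup>2\<close> times the identity, so it
  is involutory iff \<open>a + b + c + d = 1\<close>. For such a matrix the determinant is nonzero and the minors of
  order 3 are entries up to a nonzero factor, so MDS only concerns orders 1 and 2. With \<open>x = a + b\<close> and
  \<open>y = a + c\<close> it says that \<open>x\<close> avoids 2 values, \<open>y\<close> avoids 4 values depending on \<open>x\<close>, and \<open>a\<close> avoids
  7 values depending on \<open>x\<close> and \<open>y\<close>; these are pairwise distinct, which gives the three factors.\<close>

section \<open>Submatrices and their determinants by order\<close>

text \<open>Trades the recursive definition of \<open>pick\<close> for the rank of an element in
  \<open>I\<close>, so that each selected index is found by computing one cardinality.\<close>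

lemma pick_eqI:
  assumes "i \<in> I" "card {a \<in> I. a < i} = k"
  shows "pick I k = i"
  using pick_card_in_set[OF assms(1)] assms(2) by simp

lemma det_submatrix_singleton:
  assumes "i < dim_row A" "j < dim_col A"
  shows "det (submatrix A {i} {j}) = A $$ (i, j)"
proof -
  have "{i'. i' < dim_row A \<and> i' \<in> {i}} = {i}" "{j'. j' < dim_col A \<and> j' \<in> {j}} = {j}"
    using assms by auto
  moreover have "pick {k} 0 = k" for k
  proof (rule pick_eqI)
    have "{a \<in> {k}. a < k} = {}" by auto
    then show "card {a \<in> {k}. a < k} = 0" by simp
  qed simp
  ultimately show ?thesis
    by (subst det_single) (auto simp: submatrix_def simp del: pick.simps)
qed

lemma pick_pair:
  assumes "i < j"
  shows "pick {i, j} 0 = i" "pick {i, j} (Suc 0) = j"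
proof -
  have "{a \<in> {i, j}. a < i} = {}" "{a \<in> {i, j}. a < j} = {i}"
    using assms by auto
  then have "card {a \<in> {i, j}. a < i} = 0" "card {a \<in> {i, j}. a < j} = Suc 0"
    by simp_all
  then show "pick {i, j} 0 = i" "pick {i, j} (Suc 0) = j"
    by (intro pick_eqI; simp)+
qed

lemma det_mat_order2:
  assumes "A \<in> carrier_mat 2 2"
  shows "det A = A $$ (0, 0) * A $$ (1, 1) - A $$ (0, 1) * A $$ (1, 0)"
proof -
  have "det A = (\<Sum>i<2. A $$ (i, 0) * cofactor A i 0)"
    by (rule laplace_expansion_column[OF assms]) simp
  also have "\<dots> = A $$ (0, 0) * cofactor A 0 0 + A $$ (1, 0) * cofactor A 1 0"
    by (simp add: numeral_2_eq_2)
  also have "cofactor A 0 0 = A $$ (1, 1)"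
    unfolding cofactor_def using assms
    by (subst det_single) (auto simp: mat_delete_def)
  also have "cofactor A 1 0 = - A $$ (0, 1)"
    unfolding cofactor_def using assms
    by (subst det_single) (auto simp: mat_delete_def)
  finally show ?thesis
    by (simp add: algebra_simps)
qed

lemma det_submatrix_pair:
  assumes "i < i'" "i' < dim_row A" "j < j'" "j' < dim_col A"
  shows "det (submatrix A {i, i'} {j, j'}) = A $$ (i, j) * A $$ (i', j') - A $$ (i, j') * A $$ (i', j)"
proof -
  have "{k. k < dim_row A \<and> k \<in> {i, i'}} = {i, i'}" "{k. k < dim_col A \<and> k \<in> {j, j'}} = {j, j'}"
    using assms by auto
  then have c: "card {k. k < dim_row A \<and> k \<in> {i, i'}} = 2" "card {k. k < dim_col A \<and> k \<in> {j, j'}} = 2"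
    using assms(1,3) by (simp_all only: card_2_iff) auto
  then have "submatrix A {i, i'} {j, j'} \<in> carrier_mat 2 2"
    by (intro carrier_matI) (simp_all only: dim_submatrix)
  from det_mat_order2[OF this] show ?thesis
    by (simp only: submatrix_index c pick_pair[OF assms(1)] pick_pair[OF assms(3)] One_nat_def zero_less_numeral
        numeral_2_eq_2 lessI zero_less_Suc)
qed

lemma pick_lessThan_minus:
  assumes "i < n" "k < n - 1"
  shows "pick ({..<n} - {i}) k = (if k < i then k else Suc k)"
proof (rule pick_eqI)
  show "(if k < i then k else Suc k) \<in> {..<n} - {i}"
    using assms by auto
  have "{a \<in> {..<n} - {i}. a < (if k < i then k else Suc k)} = (if k < i then {..<k} else {..<Suc k} - {i})"
    using assms by auto
  then show "card {a \<in> {..<n} - {i}. a < (if k < i then k else Suc k)} = k"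
    by simp
qed

text \<open>Links submatrices missing one row and one column to cofactors, and so to the
  adjugate.\<close>

lemma submatrix_complement_eq_mat_delete:
  assumes "i < dim_row A" "j < dim_col A"
  shows "submatrix A ({..<dim_row A} - {i}) ({..<dim_col A} - {j}) = mat_delete A i j"
proof -
  have "{k. k < dim_row A \<and> k \<in> {..<dim_row A} - {i}} = {..<dim_row A} - {i}"
       "{k. k < dim_col A \<and> k \<in> {..<dim_col A} - {j}} = {..<dim_col A} - {j}"
    by auto
  then show ?thesis
    using assms
    by (intro eq_matI) (auto simp: submatrix_def mat_delete_def pick_lessThan_minus simp del: pick.simps)
qed

lemma submatrix_lessThan: "submatrix A {..<dim_row A} {..<dim_col A} = A"
proof (rule eq_matI)
  have p: "pick {..<n} k = k" if "k < n" for k n :: nat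
  proof (rule pick_eqI)
    have "{a \<in> {..<n}. a < k} = {..<k}"
      using that by auto
    then show "card {a \<in> {..<n}. a < k} = k" by simp
  qed (use that in simp)
  show "submatrix A {..<dim_row A} {..<dim_col A} $$ (i, j) = A $$ (i, j)"
    if "i < dim_row A" "j < dim_col A" for i j
    using that by (auto simp: submatrix_def p simp del: pick.simps)
qed (auto simp: dim_submatrix)

section \<open>Minors of involutory matrices\<close>

lemma det_involutory_nonzero:
  fixes M :: "'a :: field mat"
  assumes "M \<in> carrier_mat n n" "M * M = 1\<^sub>m n"
  shows "det M \<noteq> 0"
  using det_mult[OF assms(1) assms(1)] assms(2) by auto

text \<open>The adjugate of an involution is its determinant times the matrix itself, so the minors of
  order \<open>n - 1\<close> vanish only where an entry does.\<close>

lemma det_mat_delete_involutory_nonzero: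
  fixes M :: "'a :: field mat"
  assumes M: "M \<in> carrier_mat n n" and inv: "M * M = 1\<^sub>m n"
    and ij: "i < n" "j < n" and nz: "M $$ (j, i) \<noteq> 0"
  shows "det (mat_delete M i j) \<noteq> 0"
proof -
  note adj = adj_mat[OF M]
  have "adj_mat M = (M * M) * adj_mat M"
    using inv adj(1) by simp
  also have "\<dots> = M * (M * adj_mat M)"
    by (rule assoc_mult_mat[OF M M adj(1)])
  also have "\<dots> = det M \<cdot>\<^sub>m M"
    unfolding adj(2) using M by (simp add: mult_smult_distrib[OF M one_carrier_mat])
  finally have "adj_mat M $$ (j, i) = det M * M $$ (j, i)"
    using M ij by simp
  \<comment> \<open>The adjugate is the transposed cofactor matrix, which is why deleting row
    \<open>i\<close> and column \<open>j\<close> is governed by the entry at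
    \<open>(j, i)\<close>.\<close>
  moreover have "adj_mat M $$ (j, i) = (-1) ^ (i + j) * det (mat_delete M i j)"
    using M ij by (simp add: adj_mat_def cofactor_def)
  ultimately show ?thesis
    using nz det_involutory_nonzero[OF M inv] by auto
qed

text \<open>The shapes match the determinant lemmas: pairs are ordered for
  \<open>det_submatrix_pair\<close>, and triples appear as complements of a point for
  \<open>mat_delete\<close>.\<close>

lemma subset_lessThan_cases:
  assumes "I \<subseteq> {..<4::nat}" "card I \<ge> 1"
  obtains (one) i where "i < 4" "I = {i}"
    | (two) i i' where "i < i'" "i' < 4" "I = {i, i'}"
    | (three) i where "i < 4" "I = {..<4} - {i}"
    | (four) "I = {..<4}"
proof -
  have fin: "finite I"
    using assms(1) finite_subset by blast
  have "card I \<le> 4"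
    using card_mono[OF _ assms(1)] by simp
  then consider "card I = 1" | "card I = 2" | "card I = 3" | "card I = 4"
    using assms(2) by linarith
  then show thesis
  proof cases
    case 1
    then obtain i where "I = {i}" by (auto simp: card_1_singleton_iff)
    with assms(1) one show thesis by auto
  next
    case 2
    then obtain x y where "I = {x, y}" "x \<noteq> y" by (auto simp: card_2_iff)
    then have "I = {min x y, max x y}" "min x y < max x y" by (auto simp: min_def max_def)
    moreover have "max x y < 4" using assms(1) \<open>I = {x, y}\<close> by (simp add: max_def)
    ultimately show thesis using two by blast
  next
    case 3
    then have "card ({..<4} - I) = 1"
      using card_Diff_subset[OF fin assms(1)] by simp
    then obtain i where "{..<4} - I = {i}" by (auto simp: card_1_singleton_iff)
    then have "i < 4" "I = {..<4} - {i}" using assms(1) by auto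
    then show thesis by (rule three)
  next
    case 4
    then have "I = {..<4}"
      using assms(1) by (intro card_subset_eq) auto
    then show thesis by (rule four)
  qed
qed

text \<open>Order 4 is covered by the determinant of an involution, and order 3 follows from the
  entry condition through the adjugate.\<close>

lemma MDS_mat_involutory_order4_iff:
  fixes M :: "'a :: field mat"
  assumes M: "M \<in> carrier_mat 4 4" and inv: "M * M = 1\<^sub>m 4"
  shows "MDS_mat M \<longleftrightarrow> (\<forall>i<4. \<forall>j<4. M $$ (i, j) \<noteq> 0) \<and>
    (\<forall>i'<4. \<forall>i<i'. \<forall>j'<4. \<forall>j<j'. M $$ (i, j) * M $$ (i', j') \<noteq> M $$ (i, j') * M $$ (i', j))"
    (is "_ \<longleftrightarrow> ?entries \<and> ?minors")
proof
  assume mds: "MDS_mat M"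
  have nz: "det (submatrix M I J) \<noteq> 0"
    if "I \<subseteq> {..<4}" "J \<subseteq> {..<4}" "card I = card J" "card I \<ge> 1" for I J
    using mds M that by (auto simp: MDS_mat_def)
  have ?entries
  proof (intro allI impI)
    fix i j :: nat assume "i < 4" "j < 4"
    then show "M $$ (i, j) \<noteq> 0"
      using nz[of "{i}" "{j}"] M by (simp add: det_submatrix_singleton)
  qed
  moreover have ?minors
  proof (intro allI impI)
    fix i i' j j' :: nat assume "i' < 4" "i < i'" "j' < 4" "j < j'"
    then show "M $$ (i, j) * M $$ (i', j') \<noteq> M $$ (i, j') * M $$ (i', j)"
      using nz[of "{i, i'}" "{j, j'}"] M by (auto simp: det_submatrix_pair)
  qed
  ultimately show "?entries \<and> ?minors" by blast
next
  assume *: "?entries \<and> ?minors"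
  have "det (submatrix M I J) \<noteq> 0"
    if I: "I \<subseteq> {..<4}" "card I \<ge> 1" and J: "J \<subseteq> {..<4}" "card J \<ge> 1" and eq: "card I = card J" for I J
    using I
  proof (cases rule: subset_lessThan_cases)
    case (one i)
    from J show ?thesis
      by (cases rule: subset_lessThan_cases) (use one eq * M in \<open>auto simp: det_submatrix_singleton\<close>)
  next
    case (two i i')
    from J show ?thesis
      by (cases rule: subset_lessThan_cases) (use two eq * M in \<open>auto simp: det_submatrix_pair\<close>)
  next
    case (three i)
    from J show ?thesis
    proof (cases rule: subset_lessThan_cases)
      case J: (three j)
      have "submatrix M I J = mat_delete M i j"
        using submatrix_complement_eq_mat_delete[of i M j] M three J by simp
      then show ?thesis
        using det_mat_delete_involutory_nonzero[OF M inv] three J * by simp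
    qed (use three eq in auto)
  next
    case four
    from J show ?thesis
    proof (cases rule: subset_lessThan_cases)
      case J: four
      then show ?thesis
        using submatrix_lessThan[of M] M four det_involutory_nonzero[OF M inv] by simp
    qed (use four eq in auto)
  qed
  then show "MDS_mat M"
    using M by (auto simp: MDS_mat_def)
qed

section \<open>Hadamard matrices and involutions in characteristic 2\<close>

lemma Hada_carrier: "Hada a b c d \<in> carrier_mat 4 4"
  by (simp add: Hada_def mat_of_rows_list_def numeral_eq_Suc)

lemma Hada_inject: "Hada a b c d = Hada a' b' c' d' \<longleftrightarrow> a = a' \<and> b = b' \<and> c = c' \<and> d = d'"
proof
  assume eq: "Hada a b c d = Hada a' b' c' d'"
  have "Hada a b c d $$ (0, j) = [a, b, c, d] ! j" if "j < 4" for a b c d :: 'a and j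
    using that by (simp add: Hada_def mat_of_rows_list_def)
  then have *: "[a, b, c, d] ! j = [a', b', c', d'] ! j" if "j < 4" for j
    using eq that by metis
  show "a = a' \<and> b = b' \<and> c = c' \<and> d = d'"
    using *[of 0] *[of 1] *[of 2] *[of 3] by simp
qed simp

lemma all_less_4: "(\<forall>i<4::nat. P i) \<longleftrightarrow> P 0 \<and> P 1 \<and> P 2 \<and> P 3"
  by (auto simp: numeral_eq_Suc less_Suc_eq)

lemma all_less_pair_4:
  "(\<forall>i'<4::nat. \<forall>i<i'. P i i') \<longleftrightarrow> P 0 1 \<and> P 0 2 \<and> P 0 3 \<and> P 1 2 \<and> P 1 3 \<and> P 2 3"
  by (auto simp: numeral_eq_Suc less_Suc_eq)

lemma sum_lessThan_4:
  fixes f :: "nat \<Rightarrow> 'a :: comm_monoid_add"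
  shows "(\<Sum>k<4. f k) = f 0 + f 1 + f 2 + f 3"
  by (simp add: eval_nat_numeral)

lemma add_self_char2:
  fixes x :: "'a :: ring_1"
  assumes "(2 :: 'a) = 0"
  shows "x + x = 0"
  using assms by (metis mult_2 mult_zero_left)

text \<open>Companion of \<open>add_self_char2\<close> for right-nested sums: once
  \<open>algebra_simps\<close> has made equal terms adjacent, the two rules cancel them in pairs
  anywhere in a sum.\<close>

lemma add_self_left_char2:
  fixes x y :: "'a :: ring_1"
  assumes "(2 :: 'a) = 0"
  shows "x + (x + y) = y"
  using add_self_char2[OF assms, of x] by (simp flip: add.assoc)

text \<open>Off the diagonal every product occurs twice and cancels; on it stands the sum of the
  four squares, which is the square of the sum.\<close>

lemma Hada_square:
  fixes a b c d :: "'a :: comm_ring_1"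
  assumes char2: "(2 :: 'a) = 0"
  shows "Hada a b c d * Hada a b c d = (a + b + c + d)\<^sup>2 \<cdot>\<^sub>m 1\<^sub>m 4"
proof (rule eq_matI)
  note double = add_self_char2[OF char2] and double' = add_self_left_char2[OF char2]
  let ?H = "Hada a b c d"
  let ?rows = "[[a, b, c, d], [b, a, d, c], [c, d, a, b], [d, c, b, a]]"
  have "\<forall>i<4. \<forall>j<4. (\<Sum>k<4. ?rows ! i ! k * ?rows ! k ! j) = (if i = j then (a + b + c + d)\<^sup>2 else 0)"
    unfolding sum_lessThan_4 all_less_4
    by (simp add: algebra_simps power2_eq_square double double')
  moreover have "(?H * ?H) $$ (i, j) = (\<Sum>k<4. ?rows ! i ! k * ?rows ! k ! j)" if "i < 4" "j < 4" for i j
    using that by (simp add: Hada_def mat_of_rows_list_def scalar_prod_def atLeast0LessThan sum_lessThan_4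
        eval_nat_numeral)
  ultimately show "(?H * ?H) $$ (i, j) = ((a + b + c + d)\<^sup>2 \<cdot>\<^sub>m 1\<^sub>m 4) $$ (i, j)"
    if "i < dim_row ((a + b + c + d)\<^sup>2 \<cdot>\<^sub>m (1\<^sub>m 4 :: 'a mat))"
      "j < dim_col ((a + b + c + d)\<^sup>2 \<cdot>\<^sub>m (1\<^sub>m 4 :: 'a mat))" for i j
    using that by simp
qed (simp_all add: Hada_def mat_of_rows_list_def)

text \<open>Equal squares agree up to sign, and signs vanish in characteristic 2.\<close>

lemma square_eq_iff_char2:
  fixes x y :: "'a :: idom"
  assumes "(2 :: 'a) = 0"
  shows "x * x = y * y \<longleftrightarrow> x = y"
proof -
  have "x = - x" for x :: 'a
    using assms by (metis add_eq_0_iff mult_2 mult_zero_left)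
  then show ?thesis
    by (metis square_eq_iff)
qed

lemma involutory_Hada_iff:
  fixes a b c d :: "'a :: idom"
  assumes "(2 :: 'a) = 0"
  shows "involutory_mat (Hada a b c d) \<longleftrightarrow> a + b + c + d = 1"
proof -
  have "involutory_mat (Hada a b c d) \<longleftrightarrow> (a + b + c + d)\<^sup>2 \<cdot>\<^sub>m 1\<^sub>m 4 = (1\<^sub>m 4 :: 'a mat)"
    using Hada_carrier[of a b c d] by (auto simp: involutory_mat_def Hada_square[OF assms])
  also have "\<dots> \<longleftrightarrow> (a + b + c + d)\<^sup>2 = 1"
  proof
    assume "(a + b + c + d)\<^sup>2 \<cdot>\<^sub>m 1\<^sub>m 4 = (1\<^sub>m 4 :: 'a mat)"
    then have "((a + b + c + d)\<^sup>2 \<cdot>\<^sub>m 1\<^sub>m 4) $$ (0, 0) = (1\<^sub>m 4 :: 'a mat) $$ (0, 0)"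
      by simp
    then show "(a + b + c + d)\<^sup>2 = 1" by simp
  qed (auto intro: eq_matI)
  also have "\<dots> \<longleftrightarrow> a + b + c + d = 1"
    using square_eq_iff_char2[OF assms, of "a + b + c + d" 1] by (simp add: power2_eq_square)
  finally show ?thesis .
qed

section \<open>The MDS conditions and their excluded values\<close>

text \<open>The entry at \<open>(i, j)\<close> depends only on \<open>i\<close> XOR
  \<open>j\<close>. If the two rows and the two columns have the same XOR, the minor is a difference
  of two squares, giving an inequality between two parameters. Otherwise its four entries are
  \<open>a\<close>, \<open>b\<close>, \<open>c\<close>, \<open>d\<close> in some order, giving one
  of the product conditions.\<close>

lemma MDS_Hada_iff:
  fixes a b c d :: "'a :: field"
  assumes char2: "(2 :: 'a) = 0" and sum: "a + b + c + d = 1"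
  shows "MDS_mat (Hada a b c d) \<longleftrightarrow> a \<noteq> 0 \<and> b \<noteq> 0 \<and> c \<noteq> 0 \<and> d \<noteq> 0 \<and>
    a \<noteq> b \<and> a \<noteq> c \<and> a \<noteq> d \<and> b \<noteq> c \<and> b \<noteq> d \<and> c \<noteq> d \<and>
    a * b \<noteq> c * d \<and> a * c \<noteq> b * d \<and> a * d \<noteq> b * c"
proof -
  have H: "Hada a b c d \<in> carrier_mat 4 4" by (rule Hada_carrier)
  have "Hada a b c d * Hada a b c d = 1\<^sub>m 4"
    unfolding Hada_square[OF char2] sum by (auto intro: eq_matI)
  note iff = MDS_mat_involutory_order4_iff[OF H this]
  have entry: "Hada a b c d $$ (i, j) = [[a, b, c, d], [b, a, d, c], [c, d, a, b], [d, c, b, a]] ! i ! j"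
    if "i < 4" "j < 4" for i j
    using that by (simp add: Hada_def mat_of_rows_list_def)
  show ?thesis
    unfolding iff all_less_pair_4
    by (simp add: all_less_4 entry square_eq_iff_char2[OF char2] mult.commute) (auto simp: mult.commute)
qed

text \<open>Put \<open>b = a + x\<close>, \<open>c = a + y\<close> and \<open>d = 1 + a + b + c\<close>. In characteristic 2 the quadratic terms in \<open>a\<close>
  cancel, so every MDS condition either concerns only \<open>x\<close> and \<open>y\<close> or excludes one value of \<open>a\<close>.\<close>

lemma MDS_Hada_shift_iff:
  fixes a x y :: "'a :: field"
  assumes char2: "(2 :: 'a) = 0"
  shows "MDS_mat (Hada a (a + x) (a + y) (1 + x + y + a)) \<longleftrightarrow>
    x \<notin> {0, 1} \<and> y \<notin> {0, 1, x, 1 + x} \<and>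
    a \<notin> {0, x, y, 1 + x + y, x * y, x * (1 + x + y), y * (1 + x + y)}"
proof -
  note double = add_self_char2[OF char2] and double' = add_self_left_char2[OF char2]
  \<comment> \<open>In characteristic 2 the hypothesis says \<open>u + v = u' + v'\<close>, and each
    equation says that this common element is 0. Every equivalence below thus becomes a polynomial
    identity.\<close>
  have eqI: "(u = v) = (u' = v')" if "(u + v) + (u' + v') = 0" for u v u' v' :: 'a
    using that double by (metis add_eq_0_iff add_cancel_right_right)
  have sum: "a + (a + x) + (a + y) + (1 + x + y + a) = 1"
    by (simp add: algebra_simps double double')
  have *: "a + x = 0 \<longleftrightarrow> a = x" "a + y = 0 \<longleftrightarrow> a = y" "1 + x + y + a = 0 \<longleftrightarrow> a = 1 + x + y"
    "a = a + x \<longleftrightarrow> x = 0" "a = a + y \<longleftrightarrow> y = 0" "a = 1 + x + y + a \<longleftrightarrow> y = 1 + x"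
    "a + x = a + y \<longleftrightarrow> y = x" "a + x = 1 + x + y + a \<longleftrightarrow> y = 1" "a + y = 1 + x + y + a \<longleftrightarrow> x = 1"
    "a * (a + x) = (a + y) * (1 + x + y + a) \<longleftrightarrow> a = y * (1 + x + y)"
    "a * (a + y) = (a + x) * (1 + x + y + a) \<longleftrightarrow> a = x * (1 + x + y)"
    "a * (1 + x + y + a) = (a + x) * (a + y) \<longleftrightarrow> a = x * y"
    by (rule eqI; simp add: algebra_simps double double')+
  show ?thesis
    unfolding MDS_Hada_iff[OF char2 sum] * by auto
qed

text \<open>The sum of any two listed values is a product of factors among \<open>x\<close>,
  \<open>y\<close>, \<open>1 + x\<close>, \<open>1 + y\<close>, \<open>x + y\<close> and
  \<open>1 + x + y\<close>, all nonzero by the hypotheses.\<close>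

lemma card_excluded_values:
  fixes x y :: "'a :: field"
  assumes char2: "(2 :: 'a) = 0"
    and x: "x \<notin> {0, 1}" and y: "y \<notin> {0, 1, x, 1 + x}"
  shows "card {0, x, y, 1 + x + y, x * y, x * (1 + x + y), y * (1 + x + y)} = 7"
proof -
  note double = add_self_char2[OF char2] and double' = add_self_left_char2[OF char2]
  have sum0: "u + v = 0 \<longleftrightarrow> v = u" for u v :: 'a
    using double by (metis add_left_cancel)
  have nz: "x \<noteq> 0" "y \<noteq> 0" "1 + x \<noteq> 0" "1 + y \<noteq> 0" "x + y \<noteq> 0" "1 + x + y \<noteq> 0"
    using x y unfolding sum0 by auto
  \<comment> \<open>Each use supplies as \<open>w\<close> the factored sum of the two values, so one
    goal is a ring identity and the other the nonvanishing of the factors.\<close>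
  have ne: "u \<noteq> v" if "u = v + w" "w \<noteq> 0" for u v w :: 'a
    using that by simp
  have "x \<noteq> y"
    using y by auto
  moreover have "x \<noteq> (1 + x + y)"
    by (rule ne[of _ _ "1 + y"], simp add: algebra_simps double double') (use nz in simp)
  moreover have "x \<noteq> x * y"
    by (rule ne[of _ _ "x * (1 + y)"], simp add: algebra_simps double double') (use nz in simp)
  moreover have "x \<noteq> x * (1 + x + y)"
    by (rule ne[of _ _ "x * (x + y)"], simp add: algebra_simps double double') (use nz in simp)
  moreover have "x \<noteq> y * (1 + x + y)"
    by (rule ne[of _ _ "(1 + y) * (x + y)"], simp add: algebra_simps double double') (use nz in simp)
  moreover have "y \<noteq> (1 + x + y)"
    by (rule ne[of _ _ "1 + x"], simp add: algebra_simps double double') (use nz in simp)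
  moreover have "y \<noteq> x * y"
    by (rule ne[of _ _ "y * (1 + x)"], simp add: algebra_simps double double') (use nz in simp)
  moreover have "y \<noteq> x * (1 + x + y)"
    by (rule ne[of _ _ "(1 + x) * (x + y)"], simp add: algebra_simps double double') (use nz in simp)
  moreover have "y \<noteq> y * (1 + x + y)"
    by (rule ne[of _ _ "y * (x + y)"], simp add: algebra_simps double double') (use nz in simp)
  moreover have "(1 + x + y) \<noteq> x * y"
    by (rule ne[of _ _ "(1 + x) * (1 + y)"], simp add: algebra_simps double double') (use nz in simp)
  moreover have "(1 + x + y) \<noteq> x * (1 + x + y)"
    by (rule ne[of _ _ "(1 + x) * (1 + x + y)"], simp add: algebra_simps double double') (use nz in simp)
  moreover have "(1 + x + y) \<noteq> y * (1 + x + y)"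
    by (rule ne[of _ _ "(1 + y) * (1 + x + y)"], simp add: algebra_simps double double') (use nz in simp)
  moreover have "x * y \<noteq> x * (1 + x + y)"
    by (rule ne[of _ _ "x * (1 + x)"], simp add: algebra_simps double double') (use nz in simp)
  moreover have "x * y \<noteq> y * (1 + x + y)"
    by (rule ne[of _ _ "y * (1 + y)"], simp add: algebra_simps double double') (use nz in simp)
  moreover have "x * (1 + x + y) \<noteq> y * (1 + x + y)"
    by (rule ne[of _ _ "(x + y) * (1 + x + y)"], simp add: algebra_simps double double') (use nz in simp)
  ultimately have "distinct [0, x, y, 1 + x + y, x * y, x * (1 + x + y), y * (1 + x + y)]"
    using nz by simp
  from distinct_card[OF this] show ?thesis by simp
qed

section \<open>Counting the matrices\<close>

text \<open>The characteristic divides the order of the field, so \<open>2 ^ r\<close> is 0 in it,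
  and a field has no nonzero nilpotents.\<close>

lemma char2_of_card_power2:
  assumes "card (UNIV :: 'a :: {field, finite} set) = 2 ^ r"
  shows "(2 :: 'a) = 0"
proof -
  have "of_nat (2 ^ r) = (0 :: 'a)"
    using CHAR_dvd_CARD[where 'a = 'a] assms by (simp only: of_nat_eq_0_iff_char_dvd)
  then show ?thesis by simp
qed

theorem theorem3:
  fixes r :: nat
  assumes "r \<ge> 3"
    and "card (UNIV :: 'a :: {field, finite} set) = 2 ^ r"
  shows "int (card {M :: 'a mat. (\<exists>a b c d. M = Hada a b c d) \<and> involutory_mat M \<and> MDS_mat M})
           = (2 ^ r - 2) * (2 ^ r - 4) * (2 ^ r - 7)"
proof -
  note char2 = char2_of_card_power2[OF assms(2)]
  note double = add_self_char2[OF char2] and double' = add_self_left_char2[OF char2]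
  define Y where "Y x = - {0, 1, x, 1 + x}" for x :: 'a
  define P where "P = (SIGMA x : - {0, 1}. Y x)"
  define A where "A = (\<lambda>(x, y). - {0, x, y, 1 + x + y, x * y, x * (1 + x + y), y * (1 + x + y :: 'a)})"
  \<comment> \<open>The last argument is \<open>d\<close> as determined by
    \<open>a + b + c + d = 1\<close>, so \<open>H\<close> reaches only involutory matrices.\<close>
  define H where "H = (\<lambda>((x, y), a). Hada a (a + x) (a + y) (1 + x + y + a :: 'a))"
  have "{M :: 'a mat. (\<exists>a b c d. M = Hada a b c d) \<and> involutory_mat M \<and> MDS_mat M} = H ` Sigma P A"
    (is "?S = _")
  proof (intro equalityI subsetI)
    fix M assume "M \<in> ?S"
    then obtain a b c d where M: "M = Hada a b c d" and inv: "a + b + c + d = 1" and mds: "MDS_mat M"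
      using involutory_Hada_iff[OF char2] by auto
    define x y where "x = a + b" and "y = a + c"
    have "1 + x + y + a = d"
      unfolding x_def y_def inv[symmetric] by (simp add: algebra_simps double double')
    then have M': "M = Hada a (a + x) (a + y) (1 + x + y + a)"
      by (simp add: M x_def y_def double')
    have "((x, y), a) \<in> Sigma P A"
      using mds unfolding M' MDS_Hada_shift_iff[OF char2] by (simp add: P_def Y_def A_def)
    then show "M \<in> H ` Sigma P A"
      by (rule rev_image_eqI) (simp add: H_def M')
  next
    fix M assume "M \<in> H ` Sigma P A"
    then obtain x y a where *: "((x, y), a) \<in> Sigma P A" and M: "M = Hada a (a + x) (a + y) (1 + x + y + a)"
      by (auto simp: H_def)
    have "involutory_mat M"
      unfolding M involutory_Hada_iff[OF char2] by (simp add: algebra_simps double double')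
    moreover have "MDS_mat M"
      using * unfolding M MDS_Hada_shift_iff[OF char2] by (simp add: P_def Y_def A_def)
    ultimately show "M \<in> ?S"
      using M by blast
  qed
  \<comment> \<open>The first row returns \<open>a\<close>, and cancelling \<open>a\<close> in the
    next two entries returns \<open>x\<close> and \<open>y\<close>.\<close>
  moreover have "inj_on H (Sigma P A)"
    by (auto simp: inj_on_def H_def Hada_inject)
  moreover have "card (Sigma P A) = (2 ^ r - 2) * (2 ^ r - 4) * (2 ^ r - 7)"
  proof -
    have compl: "card (- B) = 2 ^ r - card B" for B :: "'a set"
      using card_Diff_subset[of B UNIV] assms(2) by (simp add: Compl_eq_Diff_UNIV)
    have "card (A p) = 2 ^ r - 7" if "p \<in> P" for p
    proof -
      obtain x y where p: "p = (x, y)" and "x \<notin> {0, 1}" "y \<notin> {0, 1, x, 1 + x}"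
        using \<open>p \<in> P\<close> by (auto simp: P_def Y_def)
      then show ?thesis
        using card_excluded_values[OF char2, of x y] by (simp add: p A_def compl)
    qed
    moreover have "card (Y x) = 2 ^ r - 4" if "x \<in> - {0, 1}" for x
    proof -
      have "1 + x \<noteq> 0" using that double by (metis ComplD add_left_cancel insertCI)
      then have "distinct [0, 1, x, 1 + x]" using that by auto
      from distinct_card[OF this] show ?thesis by (simp add: Y_def compl)
    qed
    ultimately show ?thesis
      by (simp add: card_SigmaI P_def compl numeral_2_eq_2)
  qed
  \<comment> \<open>The cardinalities above use truncated subtraction on \<open>nat\<close>; this
    bound lets \<open>of_nat_diff\<close> carry all three differences over to the integers.\<close>
  moreover have "(2 :: nat) ^ r \<ge> 8"
    using power_increasing[OF assms(1), of "2 :: nat"] by simp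
  ultimately show ?thesis
    by (simp add: card_image of_nat_diff)
qed

end
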